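(* Let $\rho_{AB}$ be a density matrix on a finite-dimensional bipartite Hilbert space $\mathcal{H}_A\otimes\mathcal{H}_B$, and let $$Q(\rho_{AB})=\sum_{i}\lambda_iE(|\phi_i\rangle_{AB})+\min_{U_f}\Big(\sum_{i,j}w_{ij}F(\rho_{Ai}\rho_{Aj})+\sum_{i,j}\tilde w_{ij}F(\rho_{Bi}\rho_{Bj})\Big),$$ where $\{\lambda_i,|\phi_i\rangle_{AB}\}$ is an optimal eigendecomposition of $\rho_{AB}$ and $E$, $F$, $w_{ij}$, $\tilde w_{ij}$ and $\min_{U_f}$ are as described in the context. Then $Q$ measures the quantum correlation of $\rho_{AB}$, i.e. $Q(\rho_{AB})=0$ if and only if $\rho_{AB}$ has no quantum correlation, that is, if and only if $\rho_{AB}$ is strictly classically correlated.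
   Context: All Hilbert spaces are finite-dimensional. Strictly classically correlated: $\rho_{AB}=\sum_kp_k\,|\psi_k^A\rangle\langle\psi_k^A|\otimes|\psi_k^B\rangle\langle\psi_k^B|$ with $p_k>0$, $\sum_kp_k=1$, where for each subsystem $\alpha\in\{A,B\}$ the vectors $|\psi_k^\alpha\rangle$ are chosen (repetitions allowed) from some orthonormal basis of $\mathcal{H}_\alpha$; equivalently $\rho_{AB}=\sum_{ij}\sigma_{ij}|a_i\rangle\langle a_i|\otimes|b_j\rangle\langle b_j|$ with $\sigma_{ij}\ge0$ and $\{|a_i\rangle\}$, $\{|b_j\rangle\}$ orthonormal sets. A state that is not strictly classically correlated is called quantum correlated. Entanglement function: $E$ is an entanglement (inseparability) measure on pure states: $E\ge0$, $E(|\phi\rangle)=0$ if and only if $|\phi\rangle$ is a product vector, and $E$ is invariant under local unitary transformations. Non-orthogonality function: $F(\rho_i\rho_j)$ is a function of a pair of density matrices of the same subsystem, invariant under local unitary operations, with $F(\rho_i\rho_j)=0$ if $\rho_i=\rho_j$ or $\rho_i$ is orthogonal to $\rho_j$ (i.e. $\rho_i\rho_j=0$), and $F(\rho_i\rho_j)>0$ otherwise. Weights: $w_{ij}$ and $\tilde w_{ij}$ are strictly positive weights (for example $w_{ij}=\tilde w_{ij}=\lambda_i\lambda_j$). Optimal eigendecomposition: an eigendecomposition $\rho_{AB}=\sum_{i=1}^n\lambda_i|\phi_i\rangle\langle\phi_i|$, with $n$ the rank of $\rho_{AB}$, $\lambda_i>0$ and $|\phi_i\rangle$ orthonormal. If a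 nonzero eigenvalue $\lambda_s$ has multiplicity (degeneracy) $f_s$, its eigenvectors, taken as the columns of a matrix $\Phi$, may be replaced by the columns of $\Phi'=\Phi U_{f_s}$ for any $f_s\times f_s$ unitary $U_{f_s}$. The eigendecomposition is optimal if, among all these choices, it minimizes the average entanglement $\sum_s\frac1{f_s}\sum_{j=1}^{f_s}E(|\phi_j^s\rangle_{AB})$, where $s$ runs over the distinct nonzero eigenvalues and $|\phi_j^s\rangle$, $j=1,\dots,f_s$, are the chosen eigenvectors for $\lambda_s$. Optimal eigendecompositions need not be unique. $\rho_{Ai}=\mathrm{Tr}_B|\phi_i\rangle\langle\phi_i|$ and $\rho_{Bi}=\mathrm{Tr}_A|\phi_i\rangle\langle\phi_i|$. $\min_{U_f}$ denotes the minimum over the unitaries $U_f$ within the degenerate eigenspaces that yield optimal eigendecompositions (the minima are understood to be attained). *)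

theory Defs
  imports "HOL-Analysis.Analysis"
begin

section \<open>Finite-dimensional Hilbert spaces\<close>

text \<open>
  The spaces of the subsystems are \<open>complex^'a\<close> and \<open>complex^'b\<close>, and their tensor product is
  \<open>complex^('a \<times> 'b)\<close>. The inner product on \<open>complex^'n\<close> provided by the library is the real one,
  so the Hermitian inner product (conjugate-linear in the first argument) is defined here; it
  induces the norm of the library.
\<close>

definition cinner :: "complex^'n \<Rightarrow> complex^'n \<Rightarrow> complex" where
  "cinner x y = (\<Sum>i\<in>UNIV. cnj (x $ i) * y $ i)"

definition dagger :: "complex^'n^'m \<Rightarrow> complex^'m^'n" where
  "dagger A = (\<chi> i j. cnj (A $ j $ i))"

definition unitary :: "complex^'n^'n \<Rightarrow> bool" where
  "unitary U \<longleftrightarrow> dagger U ** U = mat 1 \<and> U ** dagger U = mat 1"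

definition projector :: "complex^'n \<Rightarrow> complex^'n^'n" where
  "projector x = (\<chi> i j. x $ i * cnj (x $ j))"

definition orthonormal_basis :: "(complex^'n) set \<Rightarrow> bool" where
  "orthonormal_basis B \<longleftrightarrow>
     (\<forall>x\<in>B. \<forall>y\<in>B. cinner x y = (if x = y then 1 else 0)) \<and> vec.span B = UNIV"

definition density_matrix :: "complex^'n^'n \<Rightarrow> bool" where
  "density_matrix \<rho> \<longleftrightarrow>
     dagger \<rho> = \<rho> \<and> (\<forall>x. 0 \<le> Re (cinner x (\<rho> *v x))) \<and> trace \<rho> = 1"

definition tensor_vec :: "complex^'a \<Rightarrow> complex^'b \<Rightarrow> complex^('a::finite \<times> 'b::finite)" where
  "tensor_vec x y = (\<chi> p. x $ fst p * y $ snd p)"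

definition tensor_mat ::
    "complex^'a^'a \<Rightarrow> complex^'b^'b \<Rightarrow> complex^('a::finite \<times> 'b::finite)^('a \<times> 'b)" where
  "tensor_mat M N = (\<chi> p q. M $ fst p $ fst q * N $ snd p $ snd q)"

definition trace_B :: "complex^('a::finite \<times> 'b::finite)^('a \<times> 'b) \<Rightarrow> complex^'a^'a" where
  "trace_B M = (\<chi> i k. \<Sum>j\<in>UNIV. M $ (i, j) $ (k, j))"

definition trace_A :: "complex^('a::finite \<times> 'b::finite)^('a \<times> 'b) \<Rightarrow> complex^'b^'b" where
  "trace_A M = (\<chi> j l. \<Sum>i\<in>UNIV. M $ (i, j) $ (i, l))"


section \<open>Classical correlation, entanglement and non-orthogonality\<close>

definition strictly_classically_correlated :: "complex^('a::finite \<times> 'b::finite)^('a \<times> 'b) \<Rightarrow> bool" where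
  "strictly_classically_correlated \<rho> \<longleftrightarrow>
     (\<exists>BA BB (m::nat) (p :: nat \<Rightarrow> real) (\<psi>A :: nat \<Rightarrow> complex^'a) (\<psi>B :: nat \<Rightarrow> complex^'b).
        orthonormal_basis BA \<and> orthonormal_basis BB \<and>
        (\<forall>k<m. p k > 0 \<and> \<psi>A k \<in> BA \<and> \<psi>B k \<in> BB) \<and>
        (\<Sum>k<m. p k) = 1 \<and>
        \<rho> = (\<Sum>k<m. p k *\<^sub>R tensor_mat (projector (\<psi>A k)) (projector (\<psi>B k))))"

text \<open>Pure states are represented by unit vectors; nothing is required of \<open>E\<close> elsewhere.\<close>

definition entanglement_measure :: "(complex^('a::finite \<times> 'b::finite) \<Rightarrow> real) \<Rightarrow> bool" where
  "entanglement_measure E \<longleftrightarrow>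
     (\<forall>\<phi>. norm \<phi> = 1 \<longrightarrow> 0 \<le> E \<phi>) \<and>
     (\<forall>\<phi>. norm \<phi> = 1 \<longrightarrow> (E \<phi> = 0 \<longleftrightarrow> (\<exists>x y. \<phi> = tensor_vec x y))) \<and>
     (\<forall>\<phi> U V. norm \<phi> = 1 \<longrightarrow> unitary U \<longrightarrow> unitary V \<longrightarrow> E (tensor_mat U V *v \<phi>) = E \<phi>)"

definition non_orthogonality_function ::
    "(complex^'n^'n \<Rightarrow> complex^'n^'n \<Rightarrow> real) \<Rightarrow> bool" where
  "non_orthogonality_function F \<longleftrightarrow>
     (\<forall>\<rho> \<sigma> U. density_matrix \<rho> \<longrightarrow> density_matrix \<sigma> \<longrightarrow> unitary U \<longrightarrow>
        F (U ** \<rho> ** dagger U) (U ** \<sigma> ** dagger U) = F \<rho> \<sigma>) \<and>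
     (\<forall>\<rho> \<sigma>. density_matrix \<rho> \<longrightarrow> density_matrix \<sigma> \<longrightarrow>
        (if \<rho> = \<sigma> \<or> \<rho> ** \<sigma> = 0 then F \<rho> \<sigma> = 0 else F \<rho> \<sigma> > 0))"


section \<open>Optimal eigendecompositions\<close>

text \<open>Families are indexed by the naturals below the rank; eigenvalues occur with multiplicity.\<close>

definition eigendecomposition ::
    "complex^'n^'n \<Rightarrow> (nat \<Rightarrow> real) \<Rightarrow> (nat \<Rightarrow> complex^'n) \<Rightarrow> bool" where
  "eigendecomposition \<rho> ev \<phi> \<longleftrightarrow>
     (\<forall>i<rank \<rho>. ev i > 0) \<and>
     (\<forall>i<rank \<rho>. \<forall>j<rank \<rho>. cinner (\<phi> i) (\<phi> j) = (if i = j then 1 else 0)) \<and>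
     \<rho> = (\<Sum>i<rank \<rho>. ev i *\<^sub>R projector (\<phi> i))"

definition eigen_indices :: "nat \<Rightarrow> (nat \<Rightarrow> real) \<Rightarrow> real \<Rightarrow> nat set" where
  "eigen_indices n ev s = {j. j < n \<and> ev j = s}"

definition unitary_on :: "nat set \<Rightarrow> (nat \<Rightarrow> nat \<Rightarrow> complex) \<Rightarrow> bool" where
  "unitary_on I U \<longleftrightarrow>
     (\<forall>i\<in>I. \<forall>j\<in>I. (\<Sum>k\<in>I. cnj (U k i) * U k j) = (if i = j then 1 else 0)) \<and>
     (\<forall>i\<in>I. \<forall>j\<in>I. (\<Sum>k\<in>I. U i k * cnj (U j k)) = (if i = j then 1 else 0))"

text \<open>
  A choice of unitaries in the degenerate eigenspaces is a family \<open>U\<close> indexed by the distinct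
  eigenvalues \<open>s\<close>. The rows and columns of \<open>U s\<close> are indexed by the positions at which \<open>s\<close> occurs,
  and the columns \<open>\<phi> k\<close> of \<open>\<Phi>\<close> at these positions are replaced by those of \<open>\<Phi> U\<^sub>s\<close>.
\<close>

definition eigenspace_unitaries ::
    "nat \<Rightarrow> (nat \<Rightarrow> real) \<Rightarrow> (real \<Rightarrow> nat \<Rightarrow> nat \<Rightarrow> complex) \<Rightarrow> bool" where
  "eigenspace_unitaries n ev U \<longleftrightarrow> (\<forall>s \<in> ev ` {..<n}. unitary_on (eigen_indices n ev s) (U s))"

definition rotated ::
    "nat \<Rightarrow> (nat \<Rightarrow> real) \<Rightarrow> (real \<Rightarrow> nat \<Rightarrow> nat \<Rightarrow> complex) \<Rightarrow>
     (nat \<Rightarrow> complex^'n) \<Rightarrow> nat \<Rightarrow> complex^'n" where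
  "rotated n ev U \<phi> j = (\<Sum>k \<in> eigen_indices n ev (ev j). U (ev j) k j *s \<phi> k)"

definition average_entanglement ::
    "(complex^'n \<Rightarrow> real) \<Rightarrow> nat \<Rightarrow> (nat \<Rightarrow> real) \<Rightarrow> (nat \<Rightarrow> complex^'n) \<Rightarrow> real" where
  "average_entanglement E n ev \<phi> =
     (\<Sum>s \<in> ev ` {..<n}.
        1 / real (card (eigen_indices n ev s)) * (\<Sum>j \<in> eigen_indices n ev s. E (\<phi> j)))"

definition optimal_eigendecomposition ::
    "(complex^'n \<Rightarrow> real) \<Rightarrow> complex^'n^'n \<Rightarrow> (nat \<Rightarrow> real) \<Rightarrow> (nat \<Rightarrow> complex^'n) \<Rightarrow> bool" where
  "optimal_eigendecomposition E \<rho> ev \<phi> \<longleftrightarrow>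
     eigendecomposition \<rho> ev \<phi> \<and>
     (\<forall>U. eigenspace_unitaries (rank \<rho>) ev U \<longrightarrow>
        average_entanglement E (rank \<rho>) ev \<phi>
          \<le> average_entanglement E (rank \<rho>) ev (rotated (rank \<rho>) ev U \<phi>))"

definition optimal_unitaries ::
    "(complex^'n \<Rightarrow> real) \<Rightarrow> complex^'n^'n \<Rightarrow> (nat \<Rightarrow> real) \<Rightarrow> (nat \<Rightarrow> complex^'n) \<Rightarrow>
     (real \<Rightarrow> nat \<Rightarrow> nat \<Rightarrow> complex) set" where
  "optimal_unitaries E \<rho> ev \<phi> =
     {U. eigenspace_unitaries (rank \<rho>) ev U \<and>
         optimal_eigendecomposition E \<rho> ev (rotated (rank \<rho>) ev U \<phi>)}"


section \<open>The measure\<close>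

definition non_orthogonality_sum ::
    "(complex^'a^'a \<Rightarrow> complex^'a^'a \<Rightarrow> real) \<Rightarrow> (complex^'b^'b \<Rightarrow> complex^'b^'b \<Rightarrow> real) \<Rightarrow>
     (nat \<Rightarrow> nat \<Rightarrow> real) \<Rightarrow> (nat \<Rightarrow> nat \<Rightarrow> real) \<Rightarrow> nat \<Rightarrow> (nat \<Rightarrow> complex^('a::finite \<times> 'b::finite)) \<Rightarrow> real" where
  "non_orthogonality_sum FA FB w w' n \<phi> =
     (\<Sum>i<n. \<Sum>j<n. w i j * FA (trace_B (projector (\<phi> i))) (trace_B (projector (\<phi> j)))) +
     (\<Sum>i<n. \<Sum>j<n. w' i j * FB (trace_A (projector (\<phi> i))) (trace_A (projector (\<phi> j))))"

text \<open>
  \<open>FA\<close> and \<open>FB\<close> are the instances of the non-orthogonality function for the two subsystems. The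
  infimum is the minimum over the optimal unitaries whenever the latter is attained.
\<close>

definition Q_measure ::
    "(complex^('a::finite \<times> 'b::finite) \<Rightarrow> real) \<Rightarrow>
     (complex^'a^'a \<Rightarrow> complex^'a^'a \<Rightarrow> real) \<Rightarrow> (complex^'b^'b \<Rightarrow> complex^'b^'b \<Rightarrow> real) \<Rightarrow>
     (nat \<Rightarrow> nat \<Rightarrow> real) \<Rightarrow> (nat \<Rightarrow> nat \<Rightarrow> real) \<Rightarrow>
     complex^('a \<times> 'b)^('a \<times> 'b) \<Rightarrow> (nat \<Rightarrow> real) \<Rightarrow> (nat \<Rightarrow> complex^('a \<times> 'b)) \<Rightarrow> real" where
  "Q_measure E FA FB w w' \<rho> ev \<phi> =
     (\<Sum>i<rank \<rho>. ev i * E (\<phi> i)) +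
     (INF U \<in> optimal_unitaries E \<rho> ev \<phi>.
        non_orthogonality_sum FA FB w w' (rank \<rho>) (rotated (rank \<rho>) ev U \<phi>))"

end

theory Submission
  imports Defs
begin

text \<open>
  All terms of \<open>Q\<close> are nonnegative. If \<open>Q = 0\<close>, the given optimal eigendecomposition has average
  entanglement zero, hence so has the one attaining the minimum: its vectors are products whose
  factors are pairwise equal (up to a phase) or orthogonal, so each family of factors extends to an
  orthonormal basis. Conversely, the product vectors of a classical mixture form an
  eigendecomposition with the same eigenvalues as the given one. Two such eigendecompositions
  \<open>\<phi>, \<psi>\<close> differ by the eigenspace unitaries with entries \<open>\<langle>\<phi> k, \<psi> j\<rangle>\<close>, so the minimum ranges
  over the product one too, where every term vanishes.
\<close>

section \<open>The Hermitian inner product\<close>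

lemma cinner_commute: "cinner x y = cnj (cinner y x)"
  by (simp add: cinner_def mult.commute)

lemma cinner_scale_right: "cinner x (c *s y) = c * cinner x y"
  by (simp add: cinner_def sum_distrib_left algebra_simps)

lemma cinner_diff_right: "cinner x (y - z) = cinner x y - cinner x z"
  by (simp add: cinner_def sum_subtractf algebra_simps)

lemma cinner_sum_right: "cinner x (\<Sum>k\<in>K. f k) = (\<Sum>k\<in>K. cinner x (f k))"
proof -
  have "cinner x (\<Sum>k\<in>K. f k) = (\<Sum>i\<in>UNIV. \<Sum>k\<in>K. cnj (x $ i) * f k $ i)"
    by (simp add: cinner_def sum_distrib_left)
  also have "\<dots> = (\<Sum>k\<in>K. cinner x (f k))"
    unfolding cinner_def by (rule sum.swap)
  finally show ?thesis .
qed

lemma cinner_self: "cinner x x = of_real ((norm x)\<^sup>2)"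
proof -
  have "(norm x)\<^sup>2 = (\<Sum>i\<in>UNIV. (norm (x $ i))\<^sup>2)"
    unfolding norm_vec_def L2_set_def by (simp add: sum_nonneg)
  moreover have "cinner x x = (\<Sum>i\<in>UNIV. of_real ((norm (x $ i))\<^sup>2))"
    unfolding cinner_def by (simp only: complex_norm_square mult.commute)
  ultimately show ?thesis by simp
qed

lemma cinner_self_eq_1_iff: "cinner x x = 1 \<longleftrightarrow> norm x = 1"
proof -
  have "cinner x x = 1 \<longleftrightarrow> (norm x)\<^sup>2 = 1"
    unfolding cinner_self by (metis of_real_1 of_real_eq_iff)
  then show ?thesis by (simp add: power2_eq_1_iff)
      (metis norm_ge_zero neg_0_le_iff_le not_one_le_zero)
qed

lemma scaleR_eq_scale: "r *\<^sub>R (x::complex^'n) = of_real r *s x"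
  unfolding vec_eq_iff vector_smult_component vector_scaleR_component
  by (simp add: scaleR_conv_of_real)

lemma norm_scale: "norm (c *s (x::complex^'n)) = cmod c * norm x"
  by (simp add: norm_vec_def norm_mult L2_set_right_distrib)

section \<open>Rank-one projectors and their weighted sums\<close>

lemma projector_mult_vec: "projector x *v z = cinner x z *s x"
  by (simp add: projector_def matrix_vector_mult_def cinner_def vec_eq_iff
      sum_distrib_left sum_distrib_right algebra_simps)

lemma sum_projector_mult_vec:
  "(\<Sum>k\<in>K. ev k *\<^sub>R projector (\<phi> k)) *v z =
     (\<Sum>k\<in>K. (of_real (ev k) * cinner (\<phi> k) z) *s \<phi> k)"
proof (induction K rule: infinite_finite_induct)
  case (insert k K)
  have "(ev k *\<^sub>R projector (\<phi> k)) *v z = ev k *\<^sub>R (projector (\<phi> k) *v z)"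
    by (simp add: vec_eq_iff matrix_vector_mult_def scaleR_sum_right)
  also have "\<dots> = (of_real (ev k) * cinner (\<phi> k) z) *s \<phi> k"
    unfolding projector_mult_vec scaleR_eq_scale vector_smult_assoc ..
  finally have "(ev k *\<^sub>R projector (\<phi> k)) *v z = (of_real (ev k) * cinner (\<phi> k) z) *s \<phi> k" .
  with insert show ?case by (simp add: matrix_vector_mult_add_rdistrib)
qed auto

lemma trace_projector: "trace (projector x) = cinner x x"
  by (simp add: trace_def projector_def cinner_def mult.commute)

text \<open>Each unit vector contributes a projector of trace 1. This is how the weights of a
  spectral decomposition of a density matrix are shown to sum to 1.\<close>

lemma trace_sum_projector:
  assumes "\<And>k. k \<in> K \<Longrightarrow> cinner (\<phi> k) (\<phi> k) = 1"
  shows "trace (\<Sum>k\<in>K. ev k *\<^sub>R projector (\<phi> k)) = of_real (\<Sum>k\<in>K. ev k)"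
  using assms
proof (induction K rule: infinite_finite_induct)
  case (insert k K)
  have "trace (ev k *\<^sub>R projector (\<phi> k)) = of_real (ev k) * trace (projector (\<phi> k))"
    unfolding trace_def vector_scaleR_component sum_distrib_left by (simp add: scaleR_conv_of_real)
  also have "\<dots> = of_real (ev k)"
    using insert.prems[of k] by (simp add: trace_projector)
  finally show ?case using insert by (simp add: trace_add)
qed (auto simp: trace_def)


section \<open>Orthonormal families\<close>

text \<open>Families over an arbitrary index type cover eigenvectors listed by naturals, product
  vectors indexed by pairs and, through the identity family, sets of vectors.\<close>

definition orthonormal_on :: "'i set \<Rightarrow> ('i \<Rightarrow> complex^'n) \<Rightarrow> bool" where
  "orthonormal_on K \<phi> \<longleftrightarrow> (\<forall>i\<in>K. \<forall>j\<in>K. cinner (\<phi> i) (\<phi> j) = (if i = j then 1 else 0))"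

lemma orthonormal_on_cinner_sum:
  assumes "finite K" "orthonormal_on K \<phi>" "i \<in> K"
  shows "cinner (\<phi> i) (\<Sum>k\<in>K. c k *s \<phi> k) = c i"
proof -
  have "cinner (\<phi> i) (\<Sum>k\<in>K. c k *s \<phi> k) = (\<Sum>k\<in>K. if k = i then c k else 0)"
    unfolding cinner_sum_right using assms(2,3)
    by (intro sum.cong) (auto simp: cinner_scale_right orthonormal_on_def)
  then show ?thesis using assms(1,3) by simp
qed

text \<open>Pairing a vanishing linear combination with one of its vectors returns the coefficient
  of that vector. Independence bounds the size of orthonormal sets by the dimension, so that a
  largest one exists.\<close>

lemma orthonormal_on_independent:
  fixes B :: "(complex^'n) set"
  assumes "orthonormal_on B (\<lambda>x. x)"
  shows "vec.independent B"
proof -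
  have "c b = 0" if "finite S" "S \<subseteq> B" "(\<Sum>v\<in>S. c v *s v) = 0" "b \<in> S" for S c b
  proof -
    have "orthonormal_on S (\<lambda>x. x)"
      using assms that(2) unfolding orthonormal_on_def by blast
    from orthonormal_on_cinner_sum[OF that(1) this that(4), of c] show ?thesis
      using that(3) by (simp add: cinner_def)
  qed
  then show ?thesis
    unfolding vec.dependent_explicit by blast
qed

text \<open>An orthonormal set of maximal cardinality must span, by Gram-Schmidt.\<close>

lemma orthonormal_basis_extend:
  fixes A :: "(complex^'n) set"
  assumes "orthonormal_on A (\<lambda>x. x)"
  obtains B where "A \<subseteq> B" "orthonormal_basis B"
proof -
  let ?P = "\<lambda>B. A \<subseteq> B \<and> orthonormal_on B (\<lambda>x. x)"
  have bd: "finite B \<and> card B \<le> vec.dim (UNIV :: (complex^'n) set)"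
    if "orthonormal_on B (\<lambda>x. x)" for B :: "(complex^'n) set"
    using orthonormal_on_independent[OF that] vec.independent_card_le_dim[of B UNIV]
      vec.finiteI_independent by auto
  have "\<exists>B. ?P B \<and> (\<forall>C. ?P C \<longrightarrow> card C \<le> card B)"
  proof (rule ex_has_greatest_nat)
    show "?P A" using assms by simp
    \<comment> \<open>The maximum principle asks for a strict bound, hence the successor of the
      dimension.\<close>
    show "\<forall>C. ?P C \<longrightarrow> card C < Suc (vec.dim (UNIV :: (complex^'n) set))"
      using bd by (auto simp: less_Suc_eq_le)
  qed
  then obtain B where B: "?P B" and max: "\<And>C. ?P C \<Longrightarrow> card C \<le> card B"
    by blast
  have finB: "finite B" using bd B by blast
  have "vec.span B = UNIV"
  proof (rule ccontr)
    assume "vec.span B \<noteq> UNIV"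
    then obtain z where z: "z \<notin> vec.span B" by auto
    let ?p = "\<Sum>b\<in>B. cinner b z *s b"
    let ?y = "z - ?p"
    define y where "y = of_real (1 / norm ?y) *s ?y"
    have "?p \<in> vec.span B"
      by (intro vec.span_sum vec.span_scale vec.span_base)
    then have nz: "?y \<noteq> 0" using z by auto
    have "norm y = 1" unfolding y_def norm_scale using nz by (simp add: norm_divide)
    then have yy: "cinner y y = 1" by (simp add: cinner_self_eq_1_iff)
    have ort: "cinner b y = 0" if "b \<in> B" for b
      unfolding y_def cinner_scale_right cinner_diff_right
      using orthonormal_on_cinner_sum[OF finB _ that, of "\<lambda>x. x" "\<lambda>b. cinner b z"] B by simp
    have ort': "cinner y b = 0" if "b \<in> B" for b
      using ort[OF that] cinner_commute[of y b] by simp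
    have yB: "y \<notin> B" using ort yy by auto
    have "?P (insert y B)"
      using B yy yB ort ort' unfolding orthonormal_on_def by auto
    from max[OF this] show False using yB finB by simp
  qed
  with B have "orthonormal_basis B"
    by (auto simp: orthonormal_basis_def orthonormal_on_def)
  with B that show ?thesis by blast
qed


section \<open>Uniqueness of spectral decompositions\<close>

text \<open>
  Applying both sides to \<open>\<eta> x\<close> shows that \<open>\<eta> x\<close> lies in the span of the \<open>\<phi> k\<close>; comparing the
  inner products with \<open>\<phi> k\<close> shows that only those \<open>k\<close> with the eigenvalue of \<open>x\<close> contribute.
\<close>

lemma eigenvector_expansion:
  fixes \<phi> :: "'i \<Rightarrow> complex^'n" and \<eta> :: "'j \<Rightarrow> complex^'n"
  assumes fin: "finite K" "finite L"
    and on: "orthonormal_on K \<phi>" "orthonormal_on L \<eta>"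
    and pos: "\<And>x. x \<in> L \<Longrightarrow> \<sigma> x > 0"
    and eq: "(\<Sum>k\<in>K. ev k *\<^sub>R projector (\<phi> k)) = (\<Sum>x\<in>L. \<sigma> x *\<^sub>R projector (\<eta> x))"
    and x: "x \<in> L"
  shows "\<eta> x = (\<Sum>k | k \<in> K \<and> ev k = \<sigma> x. cinner (\<phi> k) (\<eta> x) *s \<phi> k)"
proof -
  let ?M = "(\<Sum>k\<in>K. ev k *\<^sub>R projector (\<phi> k)) *v \<eta> x"
  have M1: "?M = (\<Sum>k\<in>K. (of_real (ev k) * cinner (\<phi> k) (\<eta> x)) *s \<phi> k)"
    by (rule sum_projector_mult_vec)
  have "?M = (\<Sum>y\<in>L. if y = x then of_real (\<sigma> x) *s \<eta> x else 0)"
    unfolding eq sum_projector_mult_vec using on(2) x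
    by (intro sum.cong) (auto simp: orthonormal_on_def)
  then have M2: "?M = of_real (\<sigma> x) *s \<eta> x" using fin x by simp
  have zero: "cinner (\<phi> k) (\<eta> x) = 0" if "k \<in> K" "ev k \<noteq> \<sigma> x" for k
  proof -
    have "cinner (\<phi> k) ?M = of_real (ev k) * cinner (\<phi> k) (\<eta> x)"
      unfolding M1 using orthonormal_on_cinner_sum[OF fin(1) on(1) that(1)] by simp
    then have "of_real (ev k) * cinner (\<phi> k) (\<eta> x) = of_real (\<sigma> x) * cinner (\<phi> k) (\<eta> x)"
      unfolding M2 by (simp only: cinner_scale_right)
    with that(2) show ?thesis by simp
  qed
  have "of_real (\<sigma> x) *s \<eta> x = (\<Sum>k\<in>K. of_real (\<sigma> x) *s (cinner (\<phi> k) (\<eta> x) *s \<phi> k))"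
    unfolding M2[symmetric] M1 using zero
    by (intro sum.cong refl) (metis vector_smult_assoc mult_zero_right vec.scale_zero_left)
  also have "\<dots> = of_real (\<sigma> x) *s (\<Sum>k\<in>K. cinner (\<phi> k) (\<eta> x) *s \<phi> k)"
    by (simp add: vec.scale_sum_right)
  \<comment> \<open>Here \<open>\<sigma> x > 0\<close> is used to cancel the factor: a vector of
    eigenvalue 0 could lie outside the span of the \<open>\<phi> k\<close>.\<close>
  finally have "\<eta> x = (\<Sum>k\<in>K. cinner (\<phi> k) (\<eta> x) *s \<phi> k)"
    using pos[OF x] by simp
  also have "\<dots> = (\<Sum>k | k \<in> K \<and> ev k = \<sigma> x. cinner (\<phi> k) (\<eta> x) *s \<phi> k)"
    using fin(1) zero by (intro sum.mono_neutral_right) auto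
  finally show ?thesis .
qed

text \<open>Both sides count \<open>\<Sum> |\<langle>\<phi> k, \<eta> x\<rangle>|\<^sup>2\<close> over the two fibres, by Parseval.\<close>

lemma multiplicity_unique:
  fixes \<phi> :: "'i \<Rightarrow> complex^'n" and \<eta> :: "'j \<Rightarrow> complex^'n"
  assumes fin: "finite K" "finite L"
    and on: "orthonormal_on K \<phi>" "orthonormal_on L \<eta>"
    and pos: "\<And>k. k \<in> K \<Longrightarrow> ev k > 0" "\<And>x. x \<in> L \<Longrightarrow> \<sigma> x > 0"
    and eq: "(\<Sum>k\<in>K. ev k *\<^sub>R projector (\<phi> k)) = (\<Sum>x\<in>L. \<sigma> x *\<^sub>R projector (\<eta> x))"
  shows "card {k \<in> K. ev k = s} = card {x \<in> L. \<sigma> x = s}"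
proof -
  let ?K = "{k \<in> K. ev k = s}" and ?L = "{x \<in> L. \<sigma> x = s}"
  have 1: "(\<Sum>k\<in>?K. cinner (\<phi> k) (\<eta> x) * cinner (\<eta> x) (\<phi> k)) = 1" if "x \<in> ?L" for x
  proof -
    have x: "x \<in> L" "\<sigma> x = s" using that by auto
    \<comment> \<open>Only the second argument is expanded. The inner product is linear there, so a
      single sum without conjugates results.\<close>
    have "cinner (\<eta> x) (\<eta> x) = (\<Sum>k\<in>?K. cinner (\<phi> k) (\<eta> x) * cinner (\<eta> x) (\<phi> k))"
      by (subst (2) eigenvector_expansion[OF fin on pos(2) eq x(1)])
        (simp_all add: x cinner_sum_right cinner_scale_right)
    with on(2) x show ?thesis by (simp add: orthonormal_on_def)
  qed
  have 2: "(\<Sum>x\<in>?L. cinner (\<phi> k) (\<eta> x) * cinner (\<eta> x) (\<phi> k)) = 1" if "k \<in> ?K" for k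
  proof -
    have k: "k \<in> K" "ev k = s" using that by auto
    have "cinner (\<phi> k) (\<phi> k) = (\<Sum>x\<in>?L. cinner (\<eta> x) (\<phi> k) * cinner (\<phi> k) (\<eta> x))"
      by (subst (2) eigenvector_expansion[OF fin(2,1) on(2,1) pos(1) eq[symmetric] k(1)])
        (simp_all add: k cinner_sum_right cinner_scale_right)
    with on(1) k show ?thesis by (simp add: orthonormal_on_def mult.commute)
  qed
  have "of_nat (card ?K) =
      (\<Sum>k\<in>?K. \<Sum>x\<in>?L. cinner (\<phi> k) (\<eta> x) * cinner (\<eta> x) (\<phi> k))"
    using 2 by simp
  also have "\<dots> = (\<Sum>x\<in>?L. \<Sum>k\<in>?K. cinner (\<phi> k) (\<eta> x) * cinner (\<eta> x) (\<phi> k))"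
    by (rule sum.swap)
  also have "\<dots> = of_nat (card ?L)"
    using 1 by simp
  finally show ?thesis by (simp only: of_nat_eq_iff)
qed

text \<open>Fibres of equal size are in bijection. The bijections chosen for the values
  \<open>s\<close> glue to \<open>k \<mapsto> h (f k) k\<close>, which is injective because images
  of different fibres have different values under \<open>g\<close>.\<close>

lemma bij_betw_of_card_fibres:
  assumes "finite K" "finite L"
    and "\<And>s. card {k \<in> K. f k = s} = card {x \<in> L. g x = s}"
  obtains h where "bij_betw h K L" "\<And>k. k \<in> K \<Longrightarrow> g (h k) = f k"
proof -
  have "\<exists>h. bij_betw h {k \<in> K. f k = s} {x \<in> L. g x = s}" for s
    using assms by (intro finite_same_card_bij) auto
  then obtain h where h: "\<And>s. bij_betw (h s) {k \<in> K. f k = s} {x \<in> L. g x = s}"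
    by metis
  have mem: "h (f k) k \<in> L \<and> g (h (f k) k) = f k" if "k \<in> K" for k
    using bij_betwE[OF h[of "f k"]] that by auto
  have "inj_on (\<lambda>k. h (f k) k) K"
  proof (rule inj_onI)
    fix k l assume *: "k \<in> K" "l \<in> K" "h (f k) k = h (f l) l"
    then have "f k = f l" using mem by metis
    then show "k = l"
      using * bij_betw_imp_inj_on[OF h[of "f k"]] by (auto dest: inj_onD)
  qed
  moreover have "(\<lambda>k. h (f k) k) ` K = L"
  proof
    show "(\<lambda>k. h (f k) k) ` K \<subseteq> L" using mem by auto
    show "L \<subseteq> (\<lambda>k. h (f k) k) ` K"
    proof
      fix x assume "x \<in> L"
      then obtain k where "k \<in> K" "f k = g x" "x = h (g x) k"
        using bij_betw_imp_surj_on[OF h[of "g x"]] by (auto simp: set_eq_iff image_iff)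
      then show "x \<in> (\<lambda>k. h (f k) k) ` K" by (intro image_eqI[of _ _ k]) auto
    qed
  qed
  ultimately show ?thesis
    using mem by (intro that[of "\<lambda>k. h (f k) k"]) (auto simp: bij_betw_def)
qed

section \<open>Eigendecompositions sharing a list of eigenvalues\<close>

lemma eigendecomposition_sum:
  "eigendecomposition \<rho> ev \<phi> \<Longrightarrow> (\<Sum>k<rank \<rho>. ev k *\<^sub>R projector (\<phi> k)) = \<rho>"
  unfolding eigendecomposition_def by (elim conjE) (rule sym)

lemma eigendecomposition_orthonormal_on:
  "eigendecomposition \<rho> ev \<phi> \<Longrightarrow> orthonormal_on {..<rank \<rho>} \<phi>"
  by (simp add: eigendecomposition_def orthonormal_on_def)

lemma eigendecomposition_expansion:
  assumes "eigendecomposition \<rho> ev \<phi>" "eigendecomposition \<rho> ev \<psi>" "j < rank \<rho>"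
  shows "\<psi> j = (\<Sum>k\<in>eigen_indices (rank \<rho>) ev (ev j). cinner (\<phi> k) (\<psi> j) *s \<phi> k)"
proof -
  have "(\<Sum>k<rank \<rho>. ev k *\<^sub>R projector (\<phi> k)) = (\<Sum>k<rank \<rho>. ev k *\<^sub>R projector (\<psi> k))"
    using assms(1,2)[THEN eigendecomposition_sum] by simp
  from eigenvector_expansion[OF _ _ assms(1,2)[THEN eigendecomposition_orthonormal_on] _ this,
      of j] show ?thesis
    using assms(2,3) by (simp add: eigendecomposition_def eigen_indices_def)
qed

text \<open>Expand \<open>\<psi> j\<close> in the \<open>\<phi> k\<close> of the same eigenspace and
  pair with \<open>\<psi> i\<close>. With the two families exchanged, this also yields the other
  half of unitarity.\<close>

lemma eigendecomposition_parseval: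
  assumes "eigendecomposition \<rho> ev \<phi>" "eigendecomposition \<rho> ev \<psi>"
    and "i \<in> eigen_indices (rank \<rho>) ev s" "j \<in> eigen_indices (rank \<rho>) ev s"
  shows "(\<Sum>k\<in>eigen_indices (rank \<rho>) ev s. cinner (\<psi> i) (\<phi> k) * cinner (\<phi> k) (\<psi> j)) =
    (if i = j then 1 else 0)"
proof -
  let ?I = "eigen_indices (rank \<rho>) ev s"
  have i: "i < rank \<rho>" and j: "j < rank \<rho>" "ev j = s"
    using assms(3,4) by (auto simp: eigen_indices_def)
  have "\<psi> j = (\<Sum>k\<in>?I. cinner (\<phi> k) (\<psi> j) *s \<phi> k)"
    using eigendecomposition_expansion[OF assms(1,2) j(1)] j(2) by simp
  then have "cinner (\<psi> i) (\<psi> j) = cinner (\<psi> i) (\<Sum>k\<in>?I. cinner (\<phi> k) (\<psi> j) *s \<phi> k)"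
    by simp
  also have "\<dots> = (\<Sum>k\<in>?I. cinner (\<psi> i) (\<phi> k) * cinner (\<phi> k) (\<psi> j))"
    by (simp add: cinner_sum_right cinner_scale_right mult.commute)
  finally show ?thesis
    using eigendecomposition_orthonormal_on[OF assms(2)] i j by (simp add: orthonormal_on_def)
qed

text \<open>The change of basis between two orthonormal bases of each eigenspace is unitary. Thus
  minimizing over eigenspace unitaries is minimizing over all eigendecompositions with these
  eigenvalues in this order.\<close>

lemma eigendecomposition_rotated:
  assumes "eigendecomposition \<rho> ev \<phi>" "eigendecomposition \<rho> ev \<psi>"
  obtains U where "eigenspace_unitaries (rank \<rho>) ev U"
    "\<And>j. j < rank \<rho> \<Longrightarrow> rotated (rank \<rho>) ev U \<phi> j = \<psi> j"
proof
  \<comment> \<open>One formula serves every eigenvalue, since only the entries with both indices in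
    the block of \<open>s\<close> are ever consulted.\<close>
  let ?U = "\<lambda>s::real. \<lambda>k j. cinner (\<phi> k) (\<psi> j)"
  show "eigenspace_unitaries (rank \<rho>) ev ?U"
    \<comment> \<open>Conjugating an inner product swaps its arguments, which turns the column and
      row relations into Parseval for the two orders of the families.\<close>
    unfolding eigenspace_unitaries_def unitary_on_def cinner_commute[symmetric]
    using eigendecomposition_parseval[OF assms] eigendecomposition_parseval[OF assms(2,1)]
    by blast
  show "rotated (rank \<rho>) ev ?U \<phi> j = \<psi> j" if "j < rank \<rho>" for j
    using eigendecomposition_expansion[OF assms that] by (simp add: rotated_def)
qed

text \<open>The coefficients of a rotated vector form a column of a unitary matrix, which has norm
  1. Unit norm is what permits the use of \<open>E \<ge> 0\<close> on arbitrary rotations.\<close>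

lemma norm_rotated:
  assumes \<phi>: "orthonormal_on {..<n} \<phi>" and U: "eigenspace_unitaries n ev U" and j: "j < n"
  shows "norm (rotated n ev U \<phi> j) = 1"
proof -
  let ?I = "eigen_indices n ev (ev j)" and ?r = "rotated n ev U \<phi> j"
  have I: "finite ?I" "orthonormal_on ?I \<phi>" "j \<in> ?I"
    using \<phi> j by (auto simp: eigen_indices_def orthonormal_on_def)
  have coeff: "cinner (\<phi> k) ?r = U (ev j) k j" if "k \<in> ?I" for k
    unfolding rotated_def using orthonormal_on_cinner_sum[OF I(1,2) that] .
  have "cinner ?r ?r = (\<Sum>k\<in>?I. U (ev j) k j * cinner ?r (\<phi> k))"
    by (subst (2) rotated_def) (simp add: cinner_sum_right cinner_scale_right)
  also have "\<dots> = (\<Sum>k\<in>?I. cnj (U (ev j) k j) * U (ev j) k j)"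
    using coeff by (intro sum.cong) (auto simp: cinner_commute[of ?r])
  also have "\<dots> = 1"
    using U I(3) j by (auto simp: eigenspace_unitaries_def unitary_on_def)
  finally show ?thesis by (simp add: cinner_self_eq_1_iff)
qed

section \<open>Average entanglement and optimality\<close>

lemma eigendecomposition_cong:
  assumes "\<And>j. j < rank \<rho> \<Longrightarrow> \<phi> j = \<psi> j"
  shows "eigendecomposition \<rho> ev \<phi> \<longleftrightarrow> eigendecomposition \<rho> ev \<psi>"
  using assms by (simp add: eigendecomposition_def)

lemma average_entanglement_cong:
  assumes "\<And>j. j < n \<Longrightarrow> \<phi> j = \<psi> j"
  shows "average_entanglement E n ev \<phi> = average_entanglement E n ev \<psi>"
  using assms by (auto simp: average_entanglement_def eigen_indices_def intro!: sum.cong)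

text \<open>Optimality is defined by comparison with rotations only, but every eigendecomposition
  with the same eigenvalue list is such a rotation.\<close>

lemma optimal_eigendecomposition_le:
  assumes "optimal_eigendecomposition E \<rho> ev \<phi>" "eigendecomposition \<rho> ev \<psi>"
  shows "average_entanglement E (rank \<rho>) ev \<phi> \<le> average_entanglement E (rank \<rho>) ev \<psi>"
proof -
  obtain U where "eigenspace_unitaries (rank \<rho>) ev U"
    "\<And>j. j < rank \<rho> \<Longrightarrow> rotated (rank \<rho>) ev U \<phi> j = \<psi> j"
    using eigendecomposition_rotated assms by (metis optimal_eigendecomposition_def)
  \<comment> \<open>The rotation is known to agree with \<open>\<psi>\<close> only at indices below
    the rank, and the average depends on no others.\<close>
  with assms(1) show ?thesis
    using average_entanglement_cong[of "rank \<rho>" "rotated (rank \<rho>) ev U \<phi>" \<psi> E ev]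
    by (auto simp: optimal_eigendecomposition_def)
qed

text \<open>Each eigenvalue of the list occurs at some position, so the factor one over its
  multiplicity is nonzero; the position sets together exhaust all indices below
  \<open>n\<close>.\<close>

lemma average_entanglement_eq_0_iff:
  assumes "\<And>j. j < n \<Longrightarrow> 0 \<le> E (\<phi> j)"
  shows "average_entanglement E n ev \<phi> = 0 \<longleftrightarrow> (\<forall>j<n. E (\<phi> j) = 0)"
proof -
  let ?I = "eigen_indices n ev"
  have fin: "finite (?I s)" for s by (simp add: eigen_indices_def)
  have "average_entanglement E n ev \<phi> = 0 \<longleftrightarrow>
      (\<forall>s\<in>ev ` {..<n}. 1 / real (card (?I s)) * (\<Sum>j\<in>?I s. E (\<phi> j)) = 0)"
    unfolding average_entanglement_def using assms
    by (intro sum_nonneg_eq_0_iff)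
      (auto simp: eigen_indices_def intro!: divide_nonneg_nonneg sum_nonneg)
  also have "\<dots> \<longleftrightarrow> (\<forall>s\<in>ev ` {..<n}. \<forall>j\<in>?I s. E (\<phi> j) = 0)"
  proof (rule ball_cong[OF refl])
    fix s assume "s \<in> ev ` {..<n}"
    then have "?I s \<noteq> {}" by (auto simp: eigen_indices_def)
    then have "card (?I s) \<noteq> 0" using fin by simp
    moreover have "(\<Sum>j\<in>?I s. E (\<phi> j)) = 0 \<longleftrightarrow> (\<forall>j\<in>?I s. E (\<phi> j) = 0)"
      using assms fin by (intro sum_nonneg_eq_0_iff) (auto simp: eigen_indices_def)
    ultimately show "1 / real (card (?I s)) * (\<Sum>j\<in>?I s. E (\<phi> j)) = 0 \<longleftrightarrow>
        (\<forall>j\<in>?I s. E (\<phi> j) = 0)"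
      by simp
  qed
  also have "\<dots> \<longleftrightarrow> (\<forall>j<n. E (\<phi> j) = 0)"
    by (auto simp: eigen_indices_def)
  finally show ?thesis .
qed


section \<open>Tensor products and reduced states\<close>

lemma sum_UNIV_prod:
  "(\<Sum>p\<in>(UNIV :: ('a::finite \<times> 'b::finite) set). f p) = (\<Sum>i\<in>UNIV. \<Sum>j\<in>UNIV. f (i, j))"
  by (simp add: sum.cartesian_product UNIV_Times_UNIV[symmetric] del: UNIV_Times_UNIV)

lemma cinner_tensor_vec: "cinner (tensor_vec x y) (tensor_vec x' y') = cinner x x' * cinner y y'"
  by (simp add: cinner_def tensor_vec_def sum_UNIV_prod sum_product algebra_simps)

lemma norm_tensor_vec: "norm (tensor_vec x y) = norm x * norm y"
proof -
  have "complex_of_real ((norm (tensor_vec x y))\<^sup>2) = of_real ((norm x * norm y)\<^sup>2)"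
    using cinner_tensor_vec[of x y x y] by (simp add: cinner_self power_mult_distrib)
  then have "(norm (tensor_vec x y))\<^sup>2 = (norm x * norm y)\<^sup>2"
    by (simp only: of_real_eq_iff)
  then show ?thesis by (simp add: power2_eq_iff_nonneg)
qed

lemma projector_tensor_vec: "projector (tensor_vec x y) = tensor_mat (projector x) (projector y)"
  by (simp add: projector_def tensor_vec_def tensor_mat_def vec_eq_iff algebra_simps)

lemma trace_B_projector_tensor_vec:
  assumes "norm y = 1"
  shows "trace_B (projector (tensor_vec x y)) = projector x"
proof -
  have "trace_B (projector (tensor_vec x y)) $ i $ k = x $ i * cnj (x $ k) * cinner y y" for i k
    by (simp add: trace_B_def projector_def tensor_vec_def cinner_def sum_distrib_left
        algebra_simps)
  with assms show ?thesis by (simp add: vec_eq_iff projector_def cinner_self)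
qed

lemma trace_A_projector_tensor_vec:
  assumes "norm x = 1"
  shows "trace_A (projector (tensor_vec x y)) = projector y"
proof -
  have "trace_A (projector (tensor_vec x y)) $ i $ k = y $ i * cnj (y $ k) * cinner x x" for i k
    by (simp add: trace_A_def projector_def tensor_vec_def cinner_def sum_distrib_left
        algebra_simps)
  with assms show ?thesis by (simp add: vec_eq_iff projector_def cinner_self)
qed

lemma unit_product_vector:
  assumes "\<phi> = tensor_vec x y" "norm \<phi> = 1"
  obtains x' y' where "norm x' = 1" "norm y' = 1" "\<phi> = tensor_vec x' y'"
proof
  have n: "norm x * norm y = 1" using assms norm_tensor_vec by metis
  then have nz: "norm x \<noteq> 0" by auto
  \<comment> \<open>The norm of the first factor is moved to the second, which leaves the tensor
    product unchanged.\<close>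
  let ?x = "of_real (1 / norm x) *s x" and ?y = "of_real (norm x) *s y"
  show "norm ?x = 1" using nz unfolding norm_scale by (simp add: norm_divide)
  show "norm ?y = 1" using n unfolding norm_scale by simp
  show "\<phi> = tensor_vec ?x ?y"
    using nz by (simp add: assms(1) tensor_vec_def vec_eq_iff)
qed

text \<open>The quadratic form of the reduced state at \<open>x\<close> is a sum of squared moduli
  of the partial inner products \<open>c j\<close> of \<open>x\<close> with the slices of
  \<open>\<phi>\<close>. The lemma is needed because \<open>FA\<close> is constrained on density
  matrices only.\<close>

lemma density_matrix_trace_B:
  assumes "norm \<phi> = 1"
  shows "density_matrix (trace_B (projector \<phi>))"
  unfolding density_matrix_def
proof (intro conjI allI)
  show "dagger (trace_B (projector \<phi>)) = trace_B (projector \<phi>)"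
    by (simp add: dagger_def trace_B_def projector_def vec_eq_iff mult.commute)
  have "trace (trace_B (projector \<phi>)) = cinner \<phi> \<phi>"
    by (simp add: trace_def trace_B_def projector_def cinner_def sum_UNIV_prod mult.commute)
  with assms show "trace (trace_B (projector \<phi>)) = 1" by (simp add: cinner_self)
  fix x
  define c where "c j = (\<Sum>i\<in>UNIV. cnj (x $ i) * \<phi> $ (i, j))" for j
  have "cinner x (trace_B (projector \<phi>) *v x) =
      (\<Sum>i\<in>UNIV. \<Sum>k\<in>UNIV. \<Sum>j\<in>UNIV. cnj (x $ i) * \<phi> $ (i, j) * (x $ k * cnj (\<phi> $ (k, j))))"
    by (simp add: cinner_def matrix_vector_mult_def trace_B_def projector_def
        sum_distrib_left sum_distrib_right algebra_simps)
  also have "\<dots> =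
      (\<Sum>i\<in>UNIV. \<Sum>j\<in>UNIV. \<Sum>k\<in>UNIV. cnj (x $ i) * \<phi> $ (i, j) * (x $ k * cnj (\<phi> $ (k, j))))"
    by (intro sum.cong refl sum.swap)
  also have "\<dots> =
      (\<Sum>j\<in>UNIV. \<Sum>i\<in>UNIV. \<Sum>k\<in>UNIV. cnj (x $ i) * \<phi> $ (i, j) * (x $ k * cnj (\<phi> $ (k, j))))"
    by (rule sum.swap)
  also have "\<dots> = (\<Sum>j\<in>UNIV. c j * cnj (c j))"
    by (simp add: c_def sum_product)
  also have "\<dots> = (\<Sum>j\<in>UNIV. of_real ((cmod (c j))\<^sup>2))"
    by (simp only: complex_norm_square)
  finally show "0 \<le> Re (cinner x (trace_B (projector \<phi>) *v x))"
    by (simp add: sum_nonneg)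
qed

lemma density_matrix_trace_A:
  assumes "norm \<phi> = 1"
  shows "density_matrix (trace_A (projector \<phi>))"
  unfolding density_matrix_def
proof (intro conjI allI)
  show "dagger (trace_A (projector \<phi>)) = trace_A (projector \<phi>)"
    by (simp add: dagger_def trace_A_def projector_def vec_eq_iff mult.commute)
  have "trace (trace_A (projector \<phi>)) = (\<Sum>j\<in>UNIV. \<Sum>i\<in>UNIV. cnj (\<phi> $ (i, j)) * \<phi> $ (i, j))"
    by (simp add: trace_def trace_A_def projector_def mult.commute)
  also have "\<dots> = cinner \<phi> \<phi>"
    unfolding cinner_def sum_UNIV_prod by (rule sum.swap)
  finally show "trace (trace_A (projector \<phi>)) = 1" using assms by (simp add: cinner_self)
  fix x
  define c where "c i = (\<Sum>j\<in>UNIV. cnj (x $ j) * \<phi> $ (i, j))" for i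
  have "cinner x (trace_A (projector \<phi>) *v x) =
      (\<Sum>j\<in>UNIV. \<Sum>l\<in>UNIV. \<Sum>i\<in>UNIV. cnj (x $ j) * \<phi> $ (i, j) * (x $ l * cnj (\<phi> $ (i, l))))"
    by (simp add: cinner_def matrix_vector_mult_def trace_A_def projector_def
        sum_distrib_left sum_distrib_right algebra_simps)
  also have "\<dots> =
      (\<Sum>j\<in>UNIV. \<Sum>i\<in>UNIV. \<Sum>l\<in>UNIV. cnj (x $ j) * \<phi> $ (i, j) * (x $ l * cnj (\<phi> $ (i, l))))"
    by (intro sum.cong refl sum.swap)
  also have "\<dots> =
      (\<Sum>i\<in>UNIV. \<Sum>j\<in>UNIV. \<Sum>l\<in>UNIV. cnj (x $ j) * \<phi> $ (i, j) * (x $ l * cnj (\<phi> $ (i, l))))"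
    by (rule sum.swap)
  also have "\<dots> = (\<Sum>i\<in>UNIV. c i * cnj (c i))"
    by (simp add: c_def sum_product)
  also have "\<dots> = (\<Sum>i\<in>UNIV. of_real ((cmod (c i))\<^sup>2))"
    by (simp only: complex_norm_square)
  finally show "0 \<le> Re (cinner x (trace_A (projector \<phi>) *v x))"
    by (simp add: sum_nonneg)
qed

text \<open>On density matrices this relation is exactly the zero set of a non-orthogonality
  function.\<close>

definition equal_or_orthogonal :: "complex^'n^'n \<Rightarrow> complex^'n^'n \<Rightarrow> bool" where
  "equal_or_orthogonal P Q \<longleftrightarrow> P = Q \<or> P ** Q = 0"

text \<open>Applied to \<open>y\<close>, the product of the projectors gives the multiple
  \<open>cinner x y\<close> of the nonzero vector \<open>x\<close>; conversely, every entry of the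
  product contains the factor \<open>cinner x y\<close>.\<close>

lemma projector_mult_projector_eq_0_iff:
  assumes "norm x = 1" "norm y = 1"
  shows "projector x ** projector y = 0 \<longleftrightarrow> cinner x y = 0"
proof
  assume "projector x ** projector y = 0"
  then have "0 = projector x *v (projector y *v y)"
    by (simp add: matrix_vector_mul_assoc)
  also have "projector y *v y = y"
    using assms cinner_self_eq_1_iff[of y] by (simp add: projector_mult_vec)
  also have "projector x *v y = cinner x y *s x"
    by (rule projector_mult_vec)
  finally show "cinner x y = 0" using assms by auto
next
  assume "cinner x y = 0"
  moreover have "(projector x ** projector y) $ i $ j = x $ i * cinner x y * cnj (y $ j)" for i j
    by (simp add: projector_def matrix_matrix_mult_def cinner_def sum_distrib_left
        sum_distrib_right algebra_simps)
  ultimately show "projector x ** projector y = 0" by (simp add: vec_eq_iff)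
qed

text \<open>One representative vector is chosen for each projector occurring in the family.\<close>

lemma orthonormal_basis_of_projectors:
  fixes a :: "nat \<Rightarrow> complex^'n"
  assumes unit: "\<And>i. i < n \<Longrightarrow> norm (a i) = 1"
    and alt: "\<And>i j. i < n \<Longrightarrow> j < n \<Longrightarrow>
      equal_or_orthogonal (projector (a i)) (projector (a j))"
  obtains B a' where "orthonormal_basis B"
    "\<And>i. i < n \<Longrightarrow> a' i \<in> B" "\<And>i. i < n \<Longrightarrow> projector (a' i) = projector (a i)"
proof -
  define r where "r P = (SOME i. i < n \<and> projector (a i) = P)" for P
  \<comment> \<open>Vectors with equal projectors may still differ by a phase. Passing to
    representatives makes them identical, so that distinct members of the new family are
    orthogonal.\<close>
  define a' where "a' i = a (r (projector (a i)))" for i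
  have r: "r (projector (a i)) < n \<and> projector (a' i) = projector (a i)" if "i < n" for i
    unfolding a'_def r_def by (rule someI2[of _ i]) (use that in auto)
  have "cinner (a' i) (a' j) = (if a' i = a' j then 1 else 0)" if ij: "i < n" "j < n" for i j
  proof (cases "projector (a i) = projector (a j)")
    case True
    then have "a' i = a' j" by (simp add: a'_def)
    moreover have "norm (a' j) = 1" unfolding a'_def using r[OF ij(2)] unit by blast
    ultimately show ?thesis by (simp add: cinner_self_eq_1_iff)
  next
    case False
    then have "a' i \<noteq> a' j" using r ij by metis
    moreover have "norm (a' i) = 1" "norm (a' j) = 1"
      unfolding a'_def using r ij unit by blast+
    moreover have "projector (a' i) ** projector (a' j) = 0"
      using False alt[OF ij] r ij unfolding equal_or_orthogonal_def by metis
    ultimately show ?thesis using projector_mult_projector_eq_0_iff by auto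
  qed
  then have "orthonormal_on (a' ` {..<n}) (\<lambda>x. x)"
    by (auto simp: orthonormal_on_def)
  then obtain B where "a' ` {..<n} \<subseteq> B" "orthonormal_basis B"
    by (rule orthonormal_basis_extend)
  then show ?thesis using r by (intro that[of B a']) auto
qed


section \<open>Strict classical correlation\<close>

lemma non_orthogonality_nonneg:
  assumes "non_orthogonality_function F" "density_matrix \<rho>" "density_matrix \<sigma>"
  shows "0 \<le> F \<rho> \<sigma>"
  using assms unfolding non_orthogonality_function_def by (metis order.strict_iff_order order_refl)

lemma non_orthogonality_eq_0_iff:
  assumes "non_orthogonality_function F" "density_matrix \<rho>" "density_matrix \<sigma>"
  shows "F \<rho> \<sigma> = 0 \<longleftrightarrow> equal_or_orthogonal \<rho> \<sigma>"
  using assms unfolding non_orthogonality_function_def equal_or_orthogonal_def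
  by (metis order.strict_iff_order)

lemma weighted_double_sum_eq_0_iff:
  fixes w f :: "nat \<Rightarrow> nat \<Rightarrow> real"
  assumes "\<And>i j. i < n \<Longrightarrow> j < n \<Longrightarrow> w i j > 0" "\<And>i j. i < n \<Longrightarrow> j < n \<Longrightarrow> f i j \<ge> 0"
  shows "0 \<le> (\<Sum>i<n. \<Sum>j<n. w i j * f i j)"
    and "(\<Sum>i<n. \<Sum>j<n. w i j * f i j) = 0 \<longleftrightarrow> (\<forall>i<n. \<forall>j<n. f i j = 0)"
proof -
  have nn: "0 \<le> w i j * f i j" if "i < n" "j < n" for i j
    using assms that by (simp add: less_imp_le)
  then show "0 \<le> (\<Sum>i<n. \<Sum>j<n. w i j * f i j)"
    by (intro sum_nonneg) auto
  have "(\<Sum>i<n. \<Sum>j<n. w i j * f i j) = 0 \<longleftrightarrow> (\<forall>i\<in>{..<n}. (\<Sum>j<n. w i j * f i j) = 0)"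
    using nn by (intro sum_nonneg_eq_0_iff) (auto intro!: sum_nonneg)
  also have "\<dots> \<longleftrightarrow> (\<forall>i\<in>{..<n}. \<forall>j\<in>{..<n}. w i j * f i j = 0)"
    using nn by (intro ball_cong refl sum_nonneg_eq_0_iff) auto
  also have "\<dots> \<longleftrightarrow> (\<forall>i<n. \<forall>j<n. f i j = 0)"
    using assms(1) by (auto simp: less_le)
  finally show "(\<Sum>i<n. \<Sum>j<n. w i j * f i j) = 0 \<longleftrightarrow> (\<forall>i<n. \<forall>j<n. f i j = 0)" .
qed

text \<open>With positive weights and nonnegative terms, both double sums vanish only termwise. Unit
  norm makes the reduced states density matrices, so that the axioms for \<open>FA\<close> and
  \<open>FB\<close> apply to them.\<close>

lemma non_orthogonality_sum_eq_0_iff: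
  fixes \<phi> :: "nat \<Rightarrow> complex^('a::finite \<times> 'b::finite)"
  assumes F: "non_orthogonality_function FA" "non_orthogonality_function FB"
    and w: "\<And>i j. i < n \<Longrightarrow> j < n \<Longrightarrow> w i j > 0" "\<And>i j. i < n \<Longrightarrow> j < n \<Longrightarrow> w' i j > 0"
    and unit: "\<And>i. i < n \<Longrightarrow> norm (\<phi> i) = 1"
  shows "0 \<le> non_orthogonality_sum FA FB w w' n \<phi>"
    and "non_orthogonality_sum FA FB w w' n \<phi> = 0 \<longleftrightarrow>
      (\<forall>i<n. \<forall>j<n.
        equal_or_orthogonal (trace_B (projector (\<phi> i))) (trace_B (projector (\<phi> j))) \<and>
        equal_or_orthogonal (trace_A (projector (\<phi> i))) (trace_A (projector (\<phi> j))))"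
proof -
  let ?a = "\<lambda>i j. FA (trace_B (projector (\<phi> i))) (trace_B (projector (\<phi> j)))"
  let ?b = "\<lambda>i j. FB (trace_A (projector (\<phi> i))) (trace_A (projector (\<phi> j)))"
  have nn: "?a i j \<ge> 0" "?b i j \<ge> 0" if "i < n" "j < n" for i j
    by (rule non_orthogonality_nonneg F density_matrix_trace_A density_matrix_trace_B unit that)+
  have ab: "?a i j = 0 \<longleftrightarrow> equal_or_orthogonal (trace_B (projector (\<phi> i))) (trace_B (projector (\<phi> j)))"
      "?b i j = 0 \<longleftrightarrow> equal_or_orthogonal (trace_A (projector (\<phi> i))) (trace_A (projector (\<phi> j)))"
    if "i < n" "j < n" for i j
    by (rule non_orthogonality_eq_0_iff F density_matrix_trace_A density_matrix_trace_B unit that)+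
  note A = weighted_double_sum_eq_0_iff[where w = w and f = ?a, OF w(1) nn(1)]
  note B = weighted_double_sum_eq_0_iff[where w = w' and f = ?b, OF w(2) nn(2)]
  show "0 \<le> non_orthogonality_sum FA FB w w' n \<phi>"
    unfolding non_orthogonality_sum_def by (rule add_nonneg_nonneg[OF A(1) B(1)])
  have "non_orthogonality_sum FA FB w w' n \<phi> = 0 \<longleftrightarrow>
      (\<forall>i<n. \<forall>j<n. ?a i j = 0) \<and> (\<forall>i<n. \<forall>j<n. ?b i j = 0)"
    unfolding non_orthogonality_sum_def
    by (simp only: add_nonneg_eq_0_iff[OF A(1) B(1)] A(2) B(2))
  also have "\<dots> \<longleftrightarrow> (\<forall>i<n. \<forall>j<n.
        equal_or_orthogonal (trace_B (projector (\<phi> i))) (trace_B (projector (\<phi> j))) \<and>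
        equal_or_orthogonal (trace_A (projector (\<phi> i))) (trace_A (projector (\<phi> j))))"
    using ab by blast
  finally show "non_orthogonality_sum FA FB w w' n \<phi> = 0 \<longleftrightarrow>
      (\<forall>i<n. \<forall>j<n.
        equal_or_orthogonal (trace_B (projector (\<phi> i))) (trace_B (projector (\<phi> j))) \<and>
        equal_or_orthogonal (trace_A (projector (\<phi> i))) (trace_A (projector (\<phi> j))))" .
qed

text \<open>Only the projectors of the factors enter the mixture, so the factors may be replaced by
  members of orthonormal bases with the same projectors. The eigenvalues become the weights and sum
  to 1 by comparing traces.\<close>

lemma strictly_classically_correlatedI:
  fixes \<rho> :: "complex^('a::finite \<times> 'b::finite)^('a \<times> 'b)"
  assumes tr: "trace \<rho> = 1"
    and dec: "eigendecomposition \<rho> ev \<psi>"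
    and unit: "\<And>i. i < rank \<rho> \<Longrightarrow> norm (a i) = 1" "\<And>i. i < rank \<rho> \<Longrightarrow> norm (b i) = 1"
    and prod: "\<And>i. i < rank \<rho> \<Longrightarrow> \<psi> i = tensor_vec (a i) (b i)"
    and alt: "\<And>i j. i < rank \<rho> \<Longrightarrow> j < rank \<rho> \<Longrightarrow>
      equal_or_orthogonal (projector (a i)) (projector (a j))"
      "\<And>i j. i < rank \<rho> \<Longrightarrow> j < rank \<rho> \<Longrightarrow>
      equal_or_orthogonal (projector (b i)) (projector (b j))"
  shows "strictly_classically_correlated \<rho>"
proof -
  let ?n = "rank \<rho>"
  obtain BA a' where A: "orthonormal_basis BA" "\<And>i. i < ?n \<Longrightarrow> a' i \<in> BA"
    "\<And>i. i < ?n \<Longrightarrow> projector (a' i) = projector (a i)"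
    using orthonormal_basis_of_projectors[of ?n a] unit(1) alt(1) by metis
  obtain BB b' where B: "orthonormal_basis BB" "\<And>i. i < ?n \<Longrightarrow> b' i \<in> BB"
    "\<And>i. i < ?n \<Longrightarrow> projector (b' i) = projector (b i)"
    using orthonormal_basis_of_projectors[of ?n b] unit(2) alt(2) by metis
  note eq = eigendecomposition_sum[OF dec]
  have "trace (\<Sum>i<?n. ev i *\<^sub>R projector (\<psi> i)) = of_real (\<Sum>i<?n. ev i)"
    using dec by (intro trace_sum_projector) (simp add: eigendecomposition_def)
  then have "complex_of_real (\<Sum>i<?n. ev i) = of_real 1"
    unfolding eq tr by simp
  then have sum1: "(\<Sum>i<?n. ev i) = 1" by (simp only: of_real_eq_iff)
  have "(\<Sum>i<?n. ev i *\<^sub>R projector (\<psi> i)) =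
      (\<Sum>i<?n. ev i *\<^sub>R tensor_mat (projector (a' i)) (projector (b' i)))"
    using A(3) B(3) prod by (intro sum.cong) (auto simp: projector_tensor_vec)
  then have "\<rho> = (\<Sum>i<?n. ev i *\<^sub>R tensor_mat (projector (a' i)) (projector (b' i)))"
    unfolding eq .
  moreover have "\<forall>i<?n. ev i > 0 \<and> a' i \<in> BA \<and> b' i \<in> BB"
    using A(2) B(2) dec by (simp add: eigendecomposition_def)
  ultimately show ?thesis
    unfolding strictly_classically_correlated_def using A(1) B(1) sum1 by blast
qed

text \<open>
  After equal pairs of basis vectors have been merged, the classical mixture is a spectral
  decomposition, so it can be re-indexed to list the eigenvalues in the given order.
\<close>

lemma strictly_classically_correlatedE:
  fixes \<rho> :: "complex^('a::finite \<times> 'b::finite)^('a \<times> 'b)"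
  assumes "strictly_classically_correlated \<rho>" and dec: "eigendecomposition \<rho> ev \<phi>"
  obtains BA BB a b where "orthonormal_basis BA" "orthonormal_basis BB"
    "\<And>i. i < rank \<rho> \<Longrightarrow> a i \<in> BA" "\<And>i. i < rank \<rho> \<Longrightarrow> b i \<in> BB"
    "eigendecomposition \<rho> ev (\<lambda>i. tensor_vec (a i) (b i))"
proof -
  let ?n = "rank \<rho>"
  obtain BA BB and m :: nat and p a b where
    BA: "orthonormal_basis BA" and BB: "orthonormal_basis BB" and
    ab: "\<And>k. k < m \<Longrightarrow> p k > 0 \<and> a k \<in> BA \<and> b k \<in> BB" and
    rho: "\<rho> = (\<Sum>k<m. p k *\<^sub>R tensor_mat (projector (a k)) (projector (b k)))"
    using assms(1) unfolding strictly_classically_correlated_def by blast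
  define S where "S = (\<lambda>k. (a k, b k)) ` {..<m}"
  define \<sigma> where "\<sigma> x = (\<Sum>k | k \<in> {..<m} \<and> (a k, b k) = x. p k)" for x
  define \<eta> where "\<eta> x = tensor_vec (fst x) (snd x)" for x :: "(complex^'a) \<times> (complex^'b)"
  have S: "finite S" "S \<subseteq> BA \<times> BB" using ab by (auto simp: S_def)
  \<comment> \<open>Every pair in \<open>S\<close> comes from some index, so the sum runs over a
    nonempty set of positive weights.\<close>
  have pos: "\<sigma> x > 0" if "x \<in> S" for x
    unfolding \<sigma>_def using that ab by (intro sum_pos) (auto simp: S_def)
  \<comment> \<open>Inner products of product vectors factor, and two distinct pairs differ in at
    least one component, whose inner product vanishes.\<close>
  have on: "orthonormal_on S \<eta>"
    unfolding orthonormal_on_def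
  proof (intro ballI)
    fix x y assume "x \<in> S" "y \<in> S"
    then have "fst x \<in> BA" "fst y \<in> BA" "snd x \<in> BB" "snd y \<in> BB" using S by auto
    then show "cinner (\<eta> x) (\<eta> y) = (if x = y then 1 else 0)"
      using BA BB unfolding \<eta>_def cinner_tensor_vec orthonormal_basis_def
      by (auto simp: prod_eq_iff)
  qed
  have "\<rho> = (\<Sum>k<m. p k *\<^sub>R projector (\<eta> (a k, b k)))"
    by (simp add: rho \<eta>_def projector_tensor_vec)
  also have "\<dots> = (\<Sum>x\<in>S. \<Sum>k | k \<in> {..<m} \<and> (a k, b k) = x. p k *\<^sub>R projector (\<eta> (a k, b k)))"
    unfolding S_def by (rule sum.image_gen) simp
  also have "\<dots> = (\<Sum>x\<in>S. \<sigma> x *\<^sub>R projector (\<eta> x))"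
    unfolding \<sigma>_def scaleR_left.sum by (intro sum.cong) auto
  finally have eqS: "\<rho> = (\<Sum>x\<in>S. \<sigma> x *\<^sub>R projector (\<eta> x))" .
  have evpos: "\<And>k. k \<in> {..<?n} \<Longrightarrow> ev k > 0"
    using dec by (simp add: eigendecomposition_def)
  have eq: "(\<Sum>k<?n. ev k *\<^sub>R projector (\<phi> k)) = (\<Sum>x\<in>S. \<sigma> x *\<^sub>R projector (\<eta> x))"
    using eigendecomposition_sum[OF dec] eqS by (rule trans)
  have "card {k \<in> {..<?n}. ev k = s} = card {x \<in> S. \<sigma> x = s}" for s
    by (rule multiplicity_unique[OF finite_lessThan S(1) eigendecomposition_orthonormal_on[OF dec]
        on evpos pos eq])
  \<comment> \<open>That \<open>S\<close> has as many elements as the rank of \<open>\<rho>\<close>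
    comes with this bijection.\<close>
  then obtain h where h: "bij_betw h {..<?n} S" "\<And>k. k \<in> {..<?n} \<Longrightarrow> \<sigma> (h k) = ev k"
    using bij_betw_of_card_fibres[OF finite_lessThan S(1)] by blast
  have hS: "h k \<in> S" if "k < ?n" for k using bij_betwE[OF h(1)] that by auto
  then have hS': "fst (h k) \<in> BA \<and> snd (h k) \<in> BB" if "k < ?n" for k
    using S(2) that by (force simp: mem_Times_iff)
  have "(\<Sum>x\<in>S. \<sigma> x *\<^sub>R projector (\<eta> x)) = (\<Sum>k<?n. \<sigma> (h k) *\<^sub>R projector (\<eta> (h k)))"
    by (rule sum.reindex_bij_betw[OF h(1), symmetric])
  also have "\<dots> = (\<Sum>k<?n. ev k *\<^sub>R projector (\<eta> (h k)))"
    using h(2) by simp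
  finally have "\<rho> = (\<Sum>k<?n. ev k *\<^sub>R projector (\<eta> (h k)))"
    by (rule trans[OF eqS])
  moreover have "cinner (\<eta> (h i)) (\<eta> (h j)) = (if i = j then 1 else 0)" if "i < ?n" "j < ?n" for i j
    using on hS that bij_betw_imp_inj_on[OF h(1)]
    by (auto simp: orthonormal_on_def inj_on_eq_iff)
  ultimately have "eigendecomposition \<rho> ev (\<lambda>k. \<eta> (h k))"
    using evpos by (simp add: eigendecomposition_def)
  then show ?thesis
    using BA BB hS' unfolding \<eta>_def
    by (intro that[of BA BB "\<lambda>k. fst (h k)" "\<lambda>k. snd (h k)"]) auto
qed

section \<open>Vanishing of the measure\<close>

lemma eigendecomposition_norm:
  "eigendecomposition \<rho> ev \<phi> \<Longrightarrow> i < rank \<rho> \<Longrightarrow> norm (\<phi> i) = 1"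
  by (simp add: eigendecomposition_def flip: cinner_self_eq_1_iff)

lemma orthonormal_basis_projectors:
  assumes "orthonormal_basis B" "x \<in> B" "y \<in> B"
  shows "equal_or_orthogonal (projector x) (projector y)"
  using assms projector_mult_projector_eq_0_iff[of x y]
  by (cases "x = y")
    (auto simp: equal_or_orthogonal_def orthonormal_basis_def simp flip: cinner_self_eq_1_iff)

theorem theorem1:
  fixes \<rho> :: "complex^('a::finite \<times> 'b::finite)^('a \<times> 'b)"
    and E :: "complex^('a \<times> 'b) \<Rightarrow> real"
    and FA :: "complex^'a^'a \<Rightarrow> complex^'a^'a \<Rightarrow> real"
    and FB :: "complex^'b^'b \<Rightarrow> complex^'b^'b \<Rightarrow> real"
    and w w' :: "nat \<Rightarrow> nat \<Rightarrow> real"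
    and ev :: "nat \<Rightarrow> real"
    and \<phi> :: "nat \<Rightarrow> complex^('a \<times> 'b)"
  assumes "density_matrix \<rho>"
    and "entanglement_measure E"
    and "non_orthogonality_function FA"
    and "non_orthogonality_function FB"
    and "\<And>i j. i < rank \<rho> \<Longrightarrow> j < rank \<rho> \<Longrightarrow> w i j > 0"
    and "\<And>i j. i < rank \<rho> \<Longrightarrow> j < rank \<rho> \<Longrightarrow> w' i j > 0"
    and "optimal_eigendecomposition E \<rho> ev \<phi>"
    and min_attained: "\<exists>U. is_arg_min
          (\<lambda>U. non_orthogonality_sum FA FB w w' (rank \<rho>) (rotated (rank \<rho>) ev U \<phi>))
          (\<lambda>U. U \<in> optimal_unitaries E \<rho> ev \<phi>) U"
  shows "Q_measure E FA FB w w' \<rho> ev \<phi> = 0 \<longleftrightarrow> strictly_classically_correlated \<rho>"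
proof -
  let ?n = "rank \<rho>"
  let ?N = "\<lambda>\<psi>. non_orthogonality_sum FA FB w w' ?n \<psi>"
  let ?R = "\<lambda>U. rotated ?n ev U \<phi>"
  let ?avg = "\<lambda>\<psi>. average_entanglement E ?n ev \<psi>"
  have dec: "eigendecomposition \<rho> ev \<phi>"
    using assms(7) by (simp add: optimal_eigendecomposition_def)
  have N_nn: "0 \<le> ?N \<psi>"
    and N_0: "?N \<psi> = 0 \<longleftrightarrow> (\<forall>i<?n. \<forall>j<?n.
        equal_or_orthogonal (trace_B (projector (\<psi> i))) (trace_B (projector (\<psi> j))) \<and>
        equal_or_orthogonal (trace_A (projector (\<psi> i))) (trace_A (projector (\<psi> j))))"
    if "eigendecomposition \<rho> ev \<psi>" for \<psi>
    by (rule non_orthogonality_sum_eq_0_iff;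
        fact assms(3-6) eigendecomposition_norm[OF that])+
  have E_nn: "0 \<le> E (\<psi> i)"
    and E_0: "E (\<psi> i) = 0 \<longleftrightarrow> (\<exists>x y. \<psi> i = tensor_vec x y)"
    if "eigendecomposition \<rho> ev \<psi>" "i < ?n" for \<psi> i
    using assms(2) eigendecomposition_norm[OF that] by (auto simp: entanglement_measure_def)
  have avg_0: "?avg \<psi> = 0 \<longleftrightarrow> (\<forall>i<?n. E (\<psi> i) = 0)"
    if "eigendecomposition \<rho> ev \<psi>" for \<psi>
    using E_nn[OF that] by (rule average_entanglement_eq_0_iff)
  have avg_nn: "0 \<le> ?avg \<psi>" if "eigendecomposition \<rho> ev \<psi>" for \<psi>
    using E_nn[OF that] unfolding average_entanglement_def
    by (intro sum_nonneg mult_nonneg_nonneg) (auto simp: eigen_indices_def)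
  have decR: "eigendecomposition \<rho> ev (?R U)" if "U \<in> optimal_unitaries E \<rho> ev \<phi>" for U
    using that by (simp add: optimal_unitaries_def optimal_eigendecomposition_def)
  obtain U0 where U0: "U0 \<in> optimal_unitaries E \<rho> ev \<phi>"
    and U0_min: "\<And>U. U \<in> optimal_unitaries E \<rho> ev \<phi> \<Longrightarrow> ?N (?R U0) \<le> ?N (?R U)"
    using min_attained by (auto simp: is_arg_min_def not_less)
  \<comment> \<open>Attainment turns the infimum into the value at one optimal decomposition, so its
    vanishing says something about actual vectors.\<close>
  have "(INF U \<in> optimal_unitaries E \<rho> ev \<phi>. ?N (?R U)) = ?N (?R U0)"
    using U0 U0_min by (intro cInf_eq_minimum) auto
  then have Q: "Q_measure E FA FB w w' \<rho> ev \<phi> = (\<Sum>i<?n. ev i * E (\<phi> i)) + ?N (?R U0)"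
    by (simp add: Q_measure_def)
  have evpos: "ev i > 0" if "i < ?n" for i
    using dec that by (simp add: eigendecomposition_def)
  have sum_0: "(\<Sum>i<?n. ev i * E (\<phi> i)) = 0 \<longleftrightarrow> (\<forall>i<?n. E (\<phi> i) = 0)"
    using evpos E_nn[OF dec] by (subst sum_nonneg_eq_0_iff) (auto simp: less_imp_le less_le)
  have "0 \<le> (\<Sum>i<?n. ev i * E (\<phi> i))"
    using evpos E_nn[OF dec] by (intro sum_nonneg) (auto simp: less_imp_le)
  \<comment> \<open>Both summands are nonnegative. They concern different families: the entanglement
    term that of \<open>\<phi>\<close>, the other that of the minimizer \<open>U0\<close>.\<close>
  then have Q0: "Q_measure E FA FB w w' \<rho> ev \<phi> = 0 \<longleftrightarrow>
      (\<forall>i<?n. E (\<phi> i) = 0) \<and> ?N (?R U0) = 0"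
    using N_nn[OF decR[OF U0]] sum_0
    unfolding Q by (simp add: add_nonneg_eq_0_iff)
  show ?thesis
  proof
    assume "Q_measure E FA FB w w' \<rho> ev \<phi> = 0"
    then have E0: "\<forall>i<?n. E (\<phi> i) = 0" and N0: "?N (?R U0) = 0" using Q0 by auto
    define \<psi> where "\<psi> = ?R U0"
    have \<psi>: "eigendecomposition \<rho> ev \<psi>" using decR[OF U0] by (simp add: \<psi>_def)
    have "optimal_eigendecomposition E \<rho> ev \<psi>"
      using U0 by (simp add: optimal_unitaries_def \<psi>_def)
    \<comment> \<open>The rotated family is itself optimal, so its average is at most that of
      \<open>\<phi>\<close>, which is 0. This carries separability over to the family for which the
      non-orthogonality sum vanishes.\<close>
    from optimal_eigendecomposition_le[OF this dec] have "?avg \<psi> = 0"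
      using avg_0[OF dec] E0 avg_nn[OF \<psi>] by simp
    then have "\<forall>i. i < ?n \<longrightarrow> (\<exists>x y. \<psi> i = tensor_vec x y)"
      using avg_0[OF \<psi>] E_0[OF \<psi>] by simp
    then have "\<forall>i. \<exists>x y. i < ?n \<longrightarrow> norm x = 1 \<and> norm y = 1 \<and> \<psi> i = tensor_vec x y"
      using unit_product_vector eigendecomposition_norm[OF \<psi>] by metis
    then obtain a b where
      ab: "\<And>i. i < ?n \<Longrightarrow> norm (a i) = 1 \<and> norm (b i) = 1 \<and> \<psi> i = tensor_vec (a i) (b i)"
      by metis
    \<comment> \<open>For product vectors the reduced states are the projectors onto the factors, so
      the conditions on reduced states become conditions on the factors.\<close>
    have red: "trace_B (projector (\<psi> i)) = projector (a i)"
      "trace_A (projector (\<psi> i)) = projector (b i)" if "i < ?n" for i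
      using ab[OF that] by (simp_all add: trace_B_projector_tensor_vec trace_A_projector_tensor_vec)
    have alt: "equal_or_orthogonal (projector (a i)) (projector (a j)) \<and>
        equal_or_orthogonal (projector (b i)) (projector (b j))"
      if "i < ?n" "j < ?n" for i j
      using N0 N_0[OF \<psi>] that red
      unfolding \<psi>_def[symmetric] by metis
    show "strictly_classically_correlated \<rho>"
      using assms(1) ab alt \<psi>
      by (intro strictly_classically_correlatedI[of \<rho> ev \<psi> a b]) (auto simp: density_matrix_def)
  next
    assume "strictly_classically_correlated \<rho>"
    then obtain BA BB a b where B: "orthonormal_basis BA" "orthonormal_basis BB"
      and ab: "\<And>i. i < ?n \<Longrightarrow> a i \<in> BA" "\<And>i. i < ?n \<Longrightarrow> b i \<in> BB"
      and \<psi>: "eigendecomposition \<rho> ev (\<lambda>i. tensor_vec (a i) (b i))"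
      using strictly_classically_correlatedE[OF _ dec] by metis
    let ?\<psi> = "\<lambda>i. tensor_vec (a i) (b i)"
    have avg\<psi>: "?avg ?\<psi> = 0"
      using avg_0[OF \<psi>] E_0[OF \<psi>] by blast
    \<comment> \<open>A product eigendecomposition brings the minimal average down to 0, which
      forces the given optimal vectors to have zero entanglement as well.\<close>
    then have E0: "\<forall>i<?n. E (\<phi> i) = 0"
      using optimal_eigendecomposition_le[OF assms(7) \<psi>] avg_nn[OF dec] avg_0[OF dec] by simp
    obtain U where U: "eigenspace_unitaries ?n ev U" "\<And>j. j < ?n \<Longrightarrow> ?R U j = ?\<psi> j"
      using eigendecomposition_rotated[OF dec \<psi>] by blast
    have decU: "eigendecomposition \<rho> ev (?R U)"
      using eigendecomposition_cong[of \<rho> "?R U" ?\<psi>] U(2) \<psi> by blast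
    have "?avg (?R U) = 0"
      using average_entanglement_cong[of ?n "?R U" ?\<psi>] U(2) avg\<psi> by simp
    \<comment> \<open>Optimality of a family with average 0 only requires every competitor to have
      nonnegative average, and for this unit norm of the rotated vectors suffices.\<close>
    moreover have "0 \<le> ?avg (rotated ?n ev V (?R U))" if V: "eigenspace_unitaries ?n ev V" for V
      using norm_rotated[OF eigendecomposition_orthonormal_on[OF decU] V] assms(2)
      unfolding average_entanglement_def
      by (intro sum_nonneg mult_nonneg_nonneg)
        (auto simp: eigen_indices_def entanglement_measure_def)
    ultimately have "optimal_eigendecomposition E \<rho> ev (?R U)"
      using decU by (simp add: optimal_eigendecomposition_def)
    then have "U \<in> optimal_unitaries E \<rho> ev \<phi>"
      using U(1) by (simp add: optimal_unitaries_def)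
    then have le: "?N (?R U0) \<le> ?N (?R U)" by (rule U0_min)
    have unit: "norm (a i) = 1" "norm (b i) = 1" if "i < ?n" for i
      using B ab[OF that] by (auto simp: orthonormal_basis_def simp flip: cinner_self_eq_1_iff)
    \<comment> \<open>All reduced states are projectors onto members of one orthonormal basis per
      subsystem, hence pairwise equal or orthogonal.\<close>
    have "?N (?R U) = 0"
      using N_0[OF decU] U(2) unit
        orthonormal_basis_projectors[OF B(1) ab(1) ab(1)]
        orthonormal_basis_projectors[OF B(2) ab(2) ab(2)]
      by (simp add: trace_B_projector_tensor_vec trace_A_projector_tensor_vec)
    then have "?N (?R U0) = 0"
      using le N_nn[OF decR[OF U0]] by force
    with E0 show "Q_measure E FA FB w w' \<rho> ev \<phi> = 0" using Q0 by blast
  qed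
qed

end
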